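(* Let $G$ be a bi-orderable group, equipped with a bi-ordering $<$, and let $\varphi\in\operatorname{Aut}(G)$ be an order-reversing automorphism. Regard the quandles $\operatorname{Alex}(G,\varphi)$ and $\operatorname{Core}(G)$ as ordered by the same order $<$. Then: (1) There is an embedding of groups $\operatorname{Z}(G)\rtimes\operatorname{C}_{\operatorname{Aut}^\circ(G)}(\varphi)\hookrightarrow\operatorname{Aut}^\circ(\operatorname{Alex}(G,\varphi))$, where $\operatorname{C}_{\operatorname{Aut}^\circ(G)}(\varphi)=\{f\in\operatorname{Aut}^\circ(G)\mid f\varphi=\varphi f\}$. (2) If $G$ is a torsion-free abelian group, then $\operatorname{Aut}^\circ(\operatorname{Core}(G))\cong G\rtimes\operatorname{Aut}^\circ(G)$.
   Context: A bi-ordering on a group $G$ is a (strict) linear order $<$ such that $x<y$ implies $zx<zy$ and $xz<yz$ for all $x,y,z\in G$. An automorphism $\varphi$ of $G$ is order-reversing if $x<y$ implies $\varphi(y)<\varphi(x)$. $\operatorname{Alex}(G,\varphi)$ is the quandle on the set $G$ with operation $x*y=\varphi(xy^{-1})y$; $\operatorname{Core}(G)$ is the quandle on the set $G$ with operation $x*y=yx^{-1}y$. A quandle automorphism is a bijection preserving $*$. $\operatorname{Z}(G)$ is the center of $G$. $\operatorname{Aut}^\circ(G)$ is the group of group automorphisms of $G$ preserving $<$; for a quandle $Q$ with a linear order, $\operatorname{Aut}^\circ(Q)$ is the group of quandle automorphisms of $Q$ preserving the order. In the semidirect products the automorphism groups act on $\operatorname{Z}(G)$, respectively $G$, in the natural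 way. *)

theory Defs
  imports "HOL-Algebra.Bij"
begin

section \<open>Bi-ordered groups\<close>

text \<open>The order is a relation on the ambient type, of which only the restriction to the
  carrier is relevant.\<close>

definition strict_linorder_on :: "'a set \<Rightarrow> ('a \<Rightarrow> 'a \<Rightarrow> bool) \<Rightarrow> bool"
  where "strict_linorder_on A lt \<longleftrightarrow> irreflp_on A lt \<and> transp_on A lt \<and> totalp_on A lt"

definition bi_ordering :: "('a, 'b) monoid_scheme \<Rightarrow> ('a \<Rightarrow> 'a \<Rightarrow> bool) \<Rightarrow> bool"
  where "bi_ordering G lt \<longleftrightarrow> strict_linorder_on (carrier G) lt \<and>
    (\<forall>x\<in>carrier G. \<forall>y\<in>carrier G. \<forall>z\<in>carrier G. lt x y \<longrightarrow>
       lt (z \<otimes>\<^bsub>G\<^esub> x) (z \<otimes>\<^bsub>G\<^esub> y) \<and> lt (x \<otimes>\<^bsub>G\<^esub> z) (y \<otimes>\<^bsub>G\<^esub> z))"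

definition order_preserving_on :: "'a set \<Rightarrow> ('a \<Rightarrow> 'a \<Rightarrow> bool) \<Rightarrow> ('a \<Rightarrow> 'a) \<Rightarrow> bool"
  where "order_preserving_on A lt f \<longleftrightarrow> (\<forall>x\<in>A. \<forall>y\<in>A. lt x y \<longrightarrow> lt (f x) (f y))"

definition order_reversing_on :: "'a set \<Rightarrow> ('a \<Rightarrow> 'a \<Rightarrow> bool) \<Rightarrow> ('a \<Rightarrow> 'a) \<Rightarrow> bool"
  where "order_reversing_on A lt f \<longleftrightarrow> (\<forall>x\<in>A. \<forall>y\<in>A. lt x y \<longrightarrow> lt (f y) (f x))"

definition torsion_free :: "('a, 'b) monoid_scheme \<Rightarrow> bool"
  where "torsion_free G \<longleftrightarrow>
    (\<forall>x\<in>carrier G. \<forall>n::nat. n > 0 \<longrightarrow> x [^]\<^bsub>G\<^esub> n = \<one>\<^bsub>G\<^esub> \<longrightarrow> x = \<one>\<^bsub>G\<^esub>)"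

definition center :: "('a, 'b) monoid_scheme \<Rightarrow> 'a set"
  where "center G = {z \<in> carrier G. \<forall>x\<in>carrier G. z \<otimes>\<^bsub>G\<^esub> x = x \<otimes>\<^bsub>G\<^esub> z}"

text \<open>The element \<open>x\<close> of \<open>G\<close> need not belong to \<open>H\<close>: an order-reversing automorphism is
  centralised by order-preserving ones inside the full automorphism group.\<close>

definition centralizer :: "('a, 'b) monoid_scheme \<Rightarrow> 'a set \<Rightarrow> 'a \<Rightarrow> 'a set"
  where "centralizer G H x = {h \<in> H. h \<otimes>\<^bsub>G\<^esub> x = x \<otimes>\<^bsub>G\<^esub> h}"

definition ord_auto :: "('a, 'b) monoid_scheme \<Rightarrow> ('a \<Rightarrow> 'a \<Rightarrow> bool) \<Rightarrow> ('a \<Rightarrow> 'a) set"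
  where "ord_auto G lt = {f \<in> auto G. order_preserving_on (carrier G) lt f}"

definition OrdAutoGroup ::
    "('a, 'b) monoid_scheme \<Rightarrow> ('a \<Rightarrow> 'a \<Rightarrow> bool) \<Rightarrow> ('a \<Rightarrow> 'a) monoid"
  where "OrdAutoGroup G lt = (AutoGroup G) \<lparr>carrier := ord_auto G lt\<rparr>"


section \<open>Semidirect products\<close>

text \<open>Here \<open>\<theta>\<close> is a left action of \<open>K\<close> on \<open>H\<close> by automorphisms; only its values on
  \<open>carrier K\<close> and \<open>carrier H\<close> are relevant.\<close>

definition semidirect ::
    "('h, 'b) monoid_scheme \<Rightarrow> ('k, 'c) monoid_scheme \<Rightarrow> ('k \<Rightarrow> 'h \<Rightarrow> 'h) \<Rightarrow> ('h \<times> 'k) monoid"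
  where "semidirect H K \<theta> =
    \<lparr>carrier = carrier H \<times> carrier K,
     mult = (\<lambda>(h, k) (h', k'). (h \<otimes>\<^bsub>H\<^esub> \<theta> k h', k \<otimes>\<^bsub>K\<^esub> k')),
     one = (\<one>\<^bsub>H\<^esub>, \<one>\<^bsub>K\<^esub>)\<rparr>"

lemma group_semidirect:
  assumes "group H" "group K"
    and hom: "\<And>k. k \<in> carrier K \<Longrightarrow> \<theta> k \<in> hom H H"
    and one: "\<And>h. h \<in> carrier H \<Longrightarrow> \<theta> \<one>\<^bsub>K\<^esub> h = h"
    and mult: "\<And>k k' h. k \<in> carrier K \<Longrightarrow> k' \<in> carrier K \<Longrightarrow> h \<in> carrier H \<Longrightarrow>
                 \<theta> (k \<otimes>\<^bsub>K\<^esub> k') h = \<theta> k (\<theta> k' h)"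
  shows "group (semidirect H K \<theta>)"
proof -
  interpret H: group H by fact
  interpret K: group K by fact
  have cl: "\<theta> k h \<in> carrier H" if "k \<in> carrier K" "h \<in> carrier H" for k h
    using hom[OF that(1)] that(2) by (auto simp: hom_def)
  have dist: "\<theta> k (h \<otimes>\<^bsub>H\<^esub> h') = \<theta> k h \<otimes>\<^bsub>H\<^esub> \<theta> k h'"
    if "k \<in> carrier K" "h \<in> carrier H" "h' \<in> carrier H" for k h h'
    using hom[OF that(1)] that(2,3) by (auto simp: hom_def)
  show ?thesis
  proof (rule groupI)
    fix x assume "x \<in> carrier (semidirect H K \<theta>)"
    then obtain h k where x: "x = (h, k)" "h \<in> carrier H" "k \<in> carrier K"
      by (auto simp: semidirect_def)
    let ?y = "(\<theta> (inv\<^bsub>K\<^esub> k) (inv\<^bsub>H\<^esub> h), inv\<^bsub>K\<^esub> k)"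
    have "\<theta> (inv\<^bsub>K\<^esub> k) (inv\<^bsub>H\<^esub> h) \<otimes>\<^bsub>H\<^esub> \<theta> (inv\<^bsub>K\<^esub> k) h = \<theta> (inv\<^bsub>K\<^esub> k) \<one>\<^bsub>H\<^esub>"
      using x by (simp flip: dist)
    also have "\<dots> = \<one>\<^bsub>H\<^esub>"
      using hom_one[OF hom[of "inv\<^bsub>K\<^esub> k"]] x \<open>group H\<close> by simp
    finally have "?y \<otimes>\<^bsub>semidirect H K \<theta>\<^esub> x = \<one>\<^bsub>semidirect H K \<theta>\<^esub>"
      using x by (simp add: semidirect_def)
    moreover have "?y \<in> carrier (semidirect H K \<theta>)"
      using x by (simp add: semidirect_def cl)
    ultimately show "\<exists>y\<in>carrier (semidirect H K \<theta>).
        y \<otimes>\<^bsub>semidirect H K \<theta>\<^esub> x = \<one>\<^bsub>semidirect H K \<theta>\<^esub>" by blast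
  qed (auto simp: semidirect_def cl one mult dist H.m_assoc K.m_assoc)
qed


section \<open>Quandles\<close>

record 'a quandle_struct = "'a partial_object" +
  qop :: "'a \<Rightarrow> 'a \<Rightarrow> 'a" (infixl "\<triangleright>\<index>" 70)

locale quandle =
  fixes Q :: "('a, 'b) quandle_struct_scheme" (structure)
  assumes qop_closed: "x \<in> carrier Q \<Longrightarrow> y \<in> carrier Q \<Longrightarrow> x \<triangleright> y \<in> carrier Q"
    and qop_idem: "x \<in> carrier Q \<Longrightarrow> x \<triangleright> x = x"
    and qop_bij: "y \<in> carrier Q \<Longrightarrow> bij_betw (\<lambda>x. x \<triangleright> y) (carrier Q) (carrier Q)"
    and qop_dist: "x \<in> carrier Q \<Longrightarrow> y \<in> carrier Q \<Longrightarrow> z \<in> carrier Q \<Longrightarrow>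
          (x \<triangleright> y) \<triangleright> z = (x \<triangleright> z) \<triangleright> (y \<triangleright> z)"

definition Alex :: "('a, 'b) monoid_scheme \<Rightarrow> ('a \<Rightarrow> 'a) \<Rightarrow> 'a quandle_struct"
  where "Alex G \<phi> =
    \<lparr>carrier = carrier G, qop = (\<lambda>x y. \<phi> (x \<otimes>\<^bsub>G\<^esub> inv\<^bsub>G\<^esub> y) \<otimes>\<^bsub>G\<^esub> y)\<rparr>"

definition Core :: "('a, 'b) monoid_scheme \<Rightarrow> 'a quandle_struct"
  where "Core G =
    \<lparr>carrier = carrier G, qop = (\<lambda>x y. y \<otimes>\<^bsub>G\<^esub> inv\<^bsub>G\<^esub> x \<otimes>\<^bsub>G\<^esub> y)\<rparr>"

text \<open>As for groups in \<^theory>\<open>HOL-Algebra.Bij\<close>, automorphisms are taken to be extensional.\<close>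

definition quandle_auto :: "('a, 'b) quandle_struct_scheme \<Rightarrow> ('a \<Rightarrow> 'a) set"
  where "quandle_auto Q = {f \<in> Bij (carrier Q).
    \<forall>x\<in>carrier Q. \<forall>y\<in>carrier Q. f (x \<triangleright>\<^bsub>Q\<^esub> y) = f x \<triangleright>\<^bsub>Q\<^esub> f y}"

definition OrdQuandleAutoGroup ::
    "('a, 'b) quandle_struct_scheme \<Rightarrow> ('a \<Rightarrow> 'a \<Rightarrow> bool) \<Rightarrow> ('a \<Rightarrow> 'a) monoid"
  where "OrdQuandleAutoGroup Q lt = (BijGroup (carrier Q))
    \<lparr>carrier := {f \<in> quandle_auto Q. order_preserving_on (carrier Q) lt f}\<rparr>"


section \<open>These structures are groups and quandles\<close>

lemma subgroup_order_preserving: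
  assumes "strict_linorder_on S lt"
  shows "subgroup {f \<in> Bij S. order_preserving_on S lt f} (BijGroup S)"
proof (rule subgroup.intro)
  show "{f \<in> Bij S. order_preserving_on S lt f} \<subseteq> carrier (BijGroup S)"
    by (auto simp: BijGroup_def)
next
  fix f g assume "f \<in> {f \<in> Bij S. order_preserving_on S lt f}"
    and "g \<in> {f \<in> Bij S. order_preserving_on S lt f}"
  moreover from this have "g ` S \<subseteq> S" by (auto dest: Bij_imp_funcset)
  ultimately show "f \<otimes>\<^bsub>BijGroup S\<^esub> g \<in> {f \<in> Bij S. order_preserving_on S lt f}"
    by (auto simp: BijGroup_def compose_Bij order_preserving_on_def compose_def
        image_subset_iff dest: compose_Bij)
next
  show "\<one>\<^bsub>BijGroup S\<^esub> \<in> {f \<in> Bij S. order_preserving_on S lt f}"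
    by (simp add: BijGroup_def id_Bij order_preserving_on_def)
next
  fix f assume "f \<in> {f \<in> Bij S. order_preserving_on S lt f}"
  then have f: "f \<in> Bij S" and op: "\<And>x y. x \<in> S \<Longrightarrow> y \<in> S \<Longrightarrow> lt x y \<Longrightarrow> lt (f x) (f y)"
    by (auto simp: order_preserving_on_def)
  have bij: "bij_betw f S S" using f by (simp add: Bij_def)
  have "lt (inv_into S f x) (inv_into S f y)" if "x \<in> S" "y \<in> S" "lt x y" for x y
  proof -
    let ?x = "inv_into S f x" and ?y = "inv_into S f y"
    have xy: "?x \<in> S" "?y \<in> S" "f ?x = x" "f ?y = y"
      using that bij f by (auto simp: Bij_inv_into_mem bij_betw_inv_into_right)
    have "\<not> lt y x" "\<not> lt x x" and ne: "x \<noteq> y"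
      using that assms by (auto simp: strict_linorder_on_def irreflp_on_def transp_on_def)
    then have "\<not> lt ?y ?x" "?x \<noteq> ?y" using op[OF xy(2,1)] xy by auto
    then show ?thesis using xy assms by (auto simp: strict_linorder_on_def totalp_on_def)
  qed
  then show "inv\<^bsub>BijGroup S\<^esub> f \<in> {f \<in> Bij S. order_preserving_on S lt f}"
    using f by (auto simp: inv_BijGroup restrict_inv_into_Bij order_preserving_on_def)
qed

lemma (in group) group_OrdAutoGroup:
  assumes "bi_ordering G lt"
  shows "group (OrdAutoGroup G lt)"
proof -
  let ?B = "BijGroup (carrier G)"
  have "ord_auto G lt = auto G \<inter> {f \<in> Bij (carrier G). order_preserving_on (carrier G) lt f}"
    by (auto simp: ord_auto_def auto_def)
  moreover have "strict_linorder_on (carrier G) lt"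
    using assms by (simp add: bi_ordering_def)
  ultimately have "subgroup (ord_auto G lt) ?B"
    using group.subgroups_Inter_pair[OF group_BijGroup subgroup_auto subgroup_order_preserving]
    by simp
  then have "group (?B\<lparr>carrier := ord_auto G lt\<rparr>)"
    by (rule subgroup.subgroup_is_group[OF _ group_BijGroup])
  then show ?thesis by (simp add: OrdAutoGroup_def AutoGroup_def)
qed

lemma (in quandle) subgroup_quandle_auto:
  "subgroup (quandle_auto Q) (BijGroup (carrier Q))"
proof (rule subgroup.intro)
  show "quandle_auto Q \<subseteq> carrier (BijGroup (carrier Q))"
    by (auto simp: BijGroup_def quandle_auto_def)
next
  fix f g assume fg: "f \<in> quandle_auto Q" "g \<in> quandle_auto Q"
  moreover from this have "\<And>x. x \<in> carrier Q \<Longrightarrow> g x \<in> carrier Q"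
    by (auto simp: quandle_auto_def dest: Bij_imp_funcset)
  ultimately show "f \<otimes>\<^bsub>BijGroup (carrier Q)\<^esub> g \<in> quandle_auto Q"
    by (auto simp: quandle_auto_def BijGroup_def compose_Bij compose_def qop_closed
        dest: compose_Bij)
next
  show "\<one>\<^bsub>BijGroup (carrier Q)\<^esub> \<in> quandle_auto Q"
    by (simp add: quandle_auto_def BijGroup_def id_Bij qop_closed)
next
  fix f assume "f \<in> quandle_auto Q"
  then show "inv\<^bsub>BijGroup (carrier Q)\<^esub> f \<in> quandle_auto Q"
    by (auto simp: quandle_auto_def inv_BijGroup restrict_inv_into_Bij qop_closed
        intro!: Bij_inv_into_lemma)
qed

lemma (in quandle) group_OrdQuandleAutoGroup:
  assumes "strict_linorder_on (carrier Q) lt"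
  shows "group (OrdQuandleAutoGroup Q lt)"
proof -
  have "{f \<in> quandle_auto Q. order_preserving_on (carrier Q) lt f} =
    quandle_auto Q \<inter> {f \<in> Bij (carrier Q). order_preserving_on (carrier Q) lt f}"
    by (auto simp: quandle_auto_def)
  then show ?thesis
    using group.subgroups_Inter_pair[OF group_BijGroup subgroup_quandle_auto
        subgroup_order_preserving[OF assms]]
    by (simp add: OrdQuandleAutoGroup_def subgroup.subgroup_is_group group_BijGroup)
qed

lemma (in group) cancel_inv:
  assumes "x \<in> carrier G" "y \<in> carrier G"
  shows "inv x \<otimes> (x \<otimes> y) = y" and "x \<otimes> (inv x \<otimes> y) = y"
  using assms by (simp_all flip: m_assoc)

lemma (in group) quandle_Core: "quandle (Core G)"
proof
  fix y assume y: "y \<in> carrier (Core G)"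
  show "bij_betw (\<lambda>x. x \<triangleright>\<^bsub>Core G\<^esub> y) (carrier (Core G)) (carrier (Core G))"
    by (rule bij_betwI[where g = "\<lambda>x. x \<triangleright>\<^bsub>Core G\<^esub> y"])
      (use y in \<open>auto simp: Core_def m_assoc inv_mult_group cancel_inv\<close>)
qed (auto simp: Core_def m_assoc inv_mult_group cancel_inv)

lemma (in group) quandle_Alex:
  assumes "\<phi> \<in> auto G"
  shows "quandle (Alex G \<phi>)"
proof -
  have cl: "\<And>x. x \<in> carrier G \<Longrightarrow> \<phi> x \<in> carrier G"
    and hm: "\<And>x y. x \<in> carrier G \<Longrightarrow> y \<in> carrier G \<Longrightarrow> \<phi> (x \<otimes> y) = \<phi> x \<otimes> \<phi> y"
    and bij: "bij_betw \<phi> (carrier G) (carrier G)"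
    using assms by (auto simp: auto_def hom_def Bij_def)
  have iv: "\<phi> (inv x) = inv (\<phi> x)" if "x \<in> carrier G" for x
  proof -
    interpret group_hom G G \<phi>
      using assms by unfold_locales (simp add: auto_def)
    show ?thesis using that by simp
  qed
  have bm: "bij_betw (\<lambda>x. x \<otimes> a) (carrier G) (carrier G)" if "a \<in> carrier G" for a
    by (rule bij_betwI[where g = "\<lambda>x. x \<otimes> inv a"]) (use that in \<open>auto simp: m_assoc\<close>)
  show ?thesis
  proof
    fix y assume "y \<in> carrier (Alex G \<phi>)"
    then have y: "y \<in> carrier G" by (simp add: Alex_def)
    have "bij_betw ((\<lambda>x. x \<otimes> y) \<circ> (\<phi> \<circ> (\<lambda>x. x \<otimes> inv y))) (carrier G) (carrier G)"
      using y by (intro bij_betw_trans[OF bij_betw_trans[OF bm bij] bm]) auto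
    then show "bij_betw (\<lambda>x. x \<triangleright>\<^bsub>Alex G \<phi>\<^esub> y) (carrier (Alex G \<phi>)) (carrier (Alex G \<phi>))"
      by (simp add: Alex_def comp_def)
  next
    fix x assume "x \<in> carrier (Alex G \<phi>)"
    then show "x \<triangleright>\<^bsub>Alex G \<phi>\<^esub> x = x"
      using iv[of x] hm[of x "inv x"] cl[of x] by (simp add: Alex_def)
  qed (auto simp: Alex_def hm iv cl m_assoc inv_mult_group cancel_inv)
qed

end

theory Submission
  imports Defs
begin

text \<open>Both parts rest on the affine maps \<open>x \<mapsto> z \<otimes> f x\<close>, which compose as the elements
  \<open>(z, f)\<close> of the semidirect product. In \<open>Alex(G, \<phi>)\<close> such a map preserves the operation because
  the central factor \<open>z\<close> cancels in \<open>x y\<inverse>\<close> and \<open>f\<close> commutes with \<open>\<phi>\<close>. In additive notation, an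
  automorphism \<open>f\<close> of \<open>Core(G)\<close> fixing \<open>0\<close> satisfies \<open>f(2y - x) = 2f(y) - f(x)\<close>, hence
  \<open>f(2y + x) = 2f(y) + f(x)\<close> and \<open>2f(x + y) = f(2x + 2y) = 2(f(x) + f(y))\<close>; cancelling the factor
  \<open>2\<close> shows that \<open>f\<close> is additive, and a general automorphism is \<open>f\<close> followed by a translation.\<close>

text \<open>The restriction to the carrier makes the map extensional, as membership in
  \<open>Bij\<close> demands. \<open>f\<close> may be any map, since quandle automorphisms not yet
  known to be homomorphisms are translated too.\<close>

definition affine_map :: "('a, 'b) monoid_scheme \<Rightarrow> 'a \<Rightarrow> ('a \<Rightarrow> 'a) \<Rightarrow> 'a \<Rightarrow> 'a"
  where "affine_map G z f = (\<lambda>x\<in>carrier G. z \<otimes>\<^bsub>G\<^esub> f x)"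

lemma affine_map_apply [simp]: "x \<in> carrier G \<Longrightarrow> affine_map G z f x = z \<otimes>\<^bsub>G\<^esub> f x"
  by (simp add: affine_map_def)

section \<open>Affine maps of a group: composition, uniqueness, order and the Alexander
  operation\<close>

context group
begin

lemma auto_closed: "f \<in> auto G \<Longrightarrow> x \<in> carrier G \<Longrightarrow> f x \<in> carrier G"
  by (auto simp: auto_def hom_def)

lemma auto_mult:
  "f \<in> auto G \<Longrightarrow> x \<in> carrier G \<Longrightarrow> y \<in> carrier G \<Longrightarrow> f (x \<otimes> y) = f x \<otimes> f y"
  by (auto simp: auto_def hom_def)

lemma auto_group_hom: "f \<in> auto G \<Longrightarrow> group_hom G G f"
  by unfold_locales (simp add: auto_def)

lemma auto_one: "f \<in> auto G \<Longrightarrow> f \<one> = \<one>"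
  using group_hom.hom_one[OF auto_group_hom] .

lemma auto_inv: "f \<in> auto G \<Longrightarrow> x \<in> carrier G \<Longrightarrow> f (inv x) = inv (f x)"
  using group_hom.hom_inv[OF auto_group_hom] .

lemma auto_Bij: "f \<in> auto G \<Longrightarrow> f \<in> Bij (carrier G)"
  by (simp add: auto_def)

lemma bij_betw_translation:
  assumes "z \<in> carrier G"
  shows "bij_betw (\<lambda>x. z \<otimes> x) (carrier G) (carrier G)"
  by (rule bij_betwI[where g = "\<lambda>x. inv z \<otimes> x"]) (use assms in \<open>auto simp: cancel_inv\<close>)

lemma translate_Bij:
  assumes "z \<in> carrier G" "f \<in> Bij (carrier G)"
  shows "affine_map G z f \<in> Bij (carrier G)"
proof -
  have "bij_betw ((\<lambda>x. z \<otimes> x) \<circ> f) (carrier G) (carrier G)"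
    using assms by (intro bij_betw_trans[OF _ bij_betw_translation]) (auto simp: Bij_def)
  then have "bij_betw (affine_map G z f) (carrier G) (carrier G)"
    by (rule iffD1[OF bij_betw_cong, rotated]) simp
  then show ?thesis by (simp add: Bij_def affine_map_def)
qed

text \<open>Since \<open>f (w \<otimes> g x) = f w \<otimes> f (g x)\<close>, translation parts
  combine exactly as in the semidirect product.\<close>

lemma compose_affine_map:
  assumes "z \<in> carrier G" "w \<in> carrier G" "f \<in> auto G" "g \<in> auto G"
  shows "compose (carrier G) (affine_map G z f) (affine_map G w g)
    = affine_map G (z \<otimes> f w) (compose (carrier G) f g)"
  using assms by (auto simp: compose_def affine_map_def auto_closed auto_mult m_assoc)

text \<open>Automorphisms fix \<open>\<one>\<close>, so the value at \<open>\<one>\<close> is the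
  translation part; cancelling it leaves the automorphism.\<close>

lemma affine_map_inject:
  assumes "z \<in> carrier G" "w \<in> carrier G" "f \<in> auto G" "g \<in> auto G"
    and eq: "affine_map G z f = affine_map G w g"
  shows "z = w" "f = g"
proof -
  have ap: "z \<otimes> f x = w \<otimes> g x" if "x \<in> carrier G" for x
    using fun_cong[OF eq, of x] that by simp
  from ap[OF one_closed] show zw: "z = w"
    using assms by (simp add: auto_one)
  show "f = g"
  proof (rule extensionalityI)
    show "f \<in> extensional (carrier G)" "g \<in> extensional (carrier G)"
      using assms by (auto dest!: auto_Bij simp: Bij_def)
    show "f x = g x" if "x \<in> carrier G" for x
      using ap[OF that] assms that by (simp add: zw auto_closed)
  qed
qed

lemma order_preserving_translate:
  assumes "bi_ordering G lt" "z \<in> carrier G"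
    and "\<And>x. x \<in> carrier G \<Longrightarrow> f x \<in> carrier G"
    and "order_preserving_on (carrier G) lt f"
  shows "order_preserving_on (carrier G) lt (affine_map G z f)"
  using assms by (simp add: order_preserving_on_def bi_ordering_def)

text \<open>Common source of both parts of the theorem: \<open>A\<close> and \<open>F\<close> become
  the center and a centralizer for \<open>Alex\<close>, and the carrier and
  \<open>ord_auto G lt\<close> for \<open>Core\<close>.\<close>

lemma affine_map_mon:
  assumes "A \<subseteq> carrier G" "F \<subseteq> auto G"
    and "\<And>z f. z \<in> A \<Longrightarrow> f \<in> F \<Longrightarrow> affine_map G z f \<in> K"
  shows "(\<lambda>(z, f). affine_map G z f) \<in>
    mon (semidirect (G\<lparr>carrier := A\<rparr>) ((AutoGroup G)\<lparr>carrier := F\<rparr>) (\<lambda>f z. f z))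
      ((BijGroup (carrier G))\<lparr>carrier := K\<rparr>)"
  unfolding mon_def
proof (intro CollectI conjI homI inj_onI; clarsimp simp: semidirect_def)
  fix z f w g assume "z \<in> A" "f \<in> F" "w \<in> A" "g \<in> F"
  then show "affine_map G (z \<otimes> f w) (f \<otimes>\<^bsub>AutoGroup G\<^esub> g) =
      affine_map G z f \<otimes>\<^bsub>BijGroup (carrier G)\<^esub> affine_map G w g"
    using assms(1,2)
    by (simp add: AutoGroup_def BijGroup_def auto_Bij translate_Bij compose_affine_map subset_iff)
next
  fix z f w g assume "z \<in> A" "f \<in> F" "w \<in> A" "g \<in> F" "affine_map G z f = affine_map G w g"
  then show "z = w \<and> f = g"
    using assms(1,2) by (auto dest: affine_map_inject[of z w f g])
qed (use assms in auto)

lemma affine_map_Alex: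
  assumes \<phi>: "\<phi> \<in> auto G" and z: "z \<in> center G" and f: "f \<in> auto G"
    and comm: "\<And>x. x \<in> carrier G \<Longrightarrow> f (\<phi> x) = \<phi> (f x)"
  shows "affine_map G z f \<in> quandle_auto (Alex G \<phi>)"
proof -
  have zc: "z \<in> carrier G" and zcomm: "\<And>x. x \<in> carrier G \<Longrightarrow> x \<otimes> z = z \<otimes> x"
    using z by (auto simp: center_def)
  have "z \<otimes> f (\<phi> (x \<otimes> inv y) \<otimes> y) = \<phi> (z \<otimes> f x \<otimes> inv (z \<otimes> f y)) \<otimes> (z \<otimes> f y)"
    if "x \<in> carrier G" "y \<in> carrier G" for x y
  proof -
    have fx: "f x \<in> carrier G" "f y \<in> carrier G" using that f by (auto simp: auto_closed)
    let ?u = "f x \<otimes> inv (f y)"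
    have u: "?u \<in> carrier G" using fx by simp
    have "z \<otimes> f x \<otimes> inv (z \<otimes> f y) = z \<otimes> ?u \<otimes> inv z"
      using fx zc by (simp add: inv_mult_group m_assoc)
    also have "\<dots> = ?u"
      using u zc by (simp add: zcomm[OF u, symmetric] m_assoc)
    finally have "\<phi> (z \<otimes> f x \<otimes> inv (z \<otimes> f y)) \<otimes> (z \<otimes> f y) = \<phi> ?u \<otimes> z \<otimes> f y"
      using u fx zc \<phi> by (simp add: m_assoc auto_closed)
    \<comment> \<open>By now \<open>z\<close> has cancelled inside the argument of
      \<open>\<phi>\<close>, so no \<open>\<phi> z\<close> occurs and the remaining \<open>z\<close>
      only has to commute with \<open>\<phi> ?u\<close>.\<close>
    also have "\<dots> = z \<otimes> (\<phi> ?u \<otimes> f y)"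
      using u fx zc \<phi> by (simp add: m_assoc auto_closed zcomm)
    also have "\<dots> = z \<otimes> f (\<phi> (x \<otimes> inv y) \<otimes> y)"
      using that f \<phi> by (simp add: auto_closed auto_mult auto_inv comm)
    finally show ?thesis ..
  qed
  then show ?thesis
    using \<phi> f zc by (auto simp: quandle_auto_def Alex_def translate_Bij auto_Bij auto_closed)
qed

end

section \<open>Ordered automorphisms of the core of an abelian group\<close>

context comm_group
begin

text \<open>The word \<open>b \<otimes> inv a \<otimes> b\<close> has total exponent one, so
  commutativity leaves exactly one factor \<open>z\<close>. Allowing any quandle automorphism
  \<open>g\<close> lets the lemma serve also to normalise \<open>g\<close> at
  \<open>\<one>\<close>.\<close>

lemma translate_Core:
  assumes "z \<in> carrier G" "g \<in> quandle_auto (Core G)"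
  shows "affine_map G z g \<in> quandle_auto (Core G)"
proof -
  have B: "g \<in> Bij (carrier G)"
    and op: "\<And>x y. x \<in> carrier G \<Longrightarrow> y \<in> carrier G \<Longrightarrow>
      g (y \<otimes> inv x \<otimes> y) = g y \<otimes> inv (g x) \<otimes> g y"
    using assms(2) by (auto simp: quandle_auto_def Core_def)
  have cl: "g x \<in> carrier G" if "x \<in> carrier G" for x
    using B that by (auto dest: Bij_imp_funcset)
  have "z \<otimes> (b \<otimes> inv a \<otimes> b) = z \<otimes> b \<otimes> inv (z \<otimes> a) \<otimes> (z \<otimes> b)"
    if "a \<in> carrier G" "b \<in> carrier G" for a b
  proof -
    have "z \<otimes> b \<otimes> inv (z \<otimes> a) = b \<otimes> inv a"
      using that assms(1) by (simp add: m_comm[of z b] inv_mult m_assoc cancel_inv)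
    then show ?thesis using that assms(1) by (simp add: m_ac)
  qed
  then show ?thesis
    using B assms(1) by (auto simp: quandle_auto_def Core_def translate_Bij op cl)
qed

text \<open>A group automorphism preserves the core operation because that operation is a group
  word.\<close>

lemma affine_map_Core:
  assumes "z \<in> carrier G" "f \<in> auto G"
  shows "affine_map G z f \<in> quandle_auto (Core G)"
  using assms
  by (intro translate_Core)
    (auto simp: quandle_auto_def Core_def auto_Bij auto_closed auto_mult auto_inv)

lemma square_inject:
  assumes "torsion_free G" "a \<in> carrier G" "b \<in> carrier G" "a \<otimes> a = b \<otimes> b"
  shows "a = b"
proof -
  have "(a \<otimes> inv b) [^] (2::nat) = (a \<otimes> a) \<otimes> inv (b \<otimes> b)"
    using assms(2,3) by (simp add: numeral_2_eq_2 inv_mult m_ac)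
  also have "\<dots> = \<one>" using assms(3) by (simp add: assms(4))
  \<comment> \<open>Torsion-freeness is applied with exponent 2.\<close>
  finally have "a \<otimes> inv b = \<one>"
    using assms unfolding torsion_free_def by (metis inv_closed m_closed zero_less_numeral)
  then show ?thesis using assms(2,3) by (metis inv_equality inv_inv inv_closed)
qed

lemma Core_auto_fixing_one:
  assumes tf: "torsion_free G" and f: "f \<in> quandle_auto (Core G)" and f1: "f \<one> = \<one>"
  shows "f \<in> auto G"
proof -
  have B: "f \<in> Bij (carrier G)"
    and op: "\<And>x y. x \<in> carrier G \<Longrightarrow> y \<in> carrier G \<Longrightarrow>
      f (y \<otimes> inv x \<otimes> y) = f y \<otimes> inv (f x) \<otimes> f y"
    using f by (auto simp: quandle_auto_def Core_def)
  have cl: "f x \<in> carrier G" if "x \<in> carrier G" for x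
    using B that by (auto dest: Bij_imp_funcset)
  \<comment> \<open>With \<open>y = \<one>\<close> the core operation is inversion.\<close>
  have finv: "f (inv x) = inv (f x)" if "x \<in> carrier G" for x
    using op[of x \<one>] that by (simp add: f1 cl)
  have shift: "f (y \<otimes> x \<otimes> y) = f y \<otimes> f x \<otimes> f y" if "x \<in> carrier G" "y \<in> carrier G" for x y
    using op[of "inv x" y] that by (simp add: finv cl)
  have double: "f (x \<otimes> x) = f x \<otimes> f x" if "x \<in> carrier G" for x
    using shift[of \<one> x] that by (simp add: f1 cl)
  have "f (x \<otimes> y) = f x \<otimes> f y" if xy: "x \<in> carrier G" "y \<in> carrier G" for x y
  proof (rule square_inject[OF tf])
    \<comment> \<open>Commutativity rearranges the square of \<open>x \<otimes> y\<close> into the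
      form of \<open>shift\<close>, with \<open>y \<otimes> y\<close> in the middle.\<close>
    have "f (x \<otimes> y) \<otimes> f (x \<otimes> y) = f (x \<otimes> (y \<otimes> y) \<otimes> x)"
      using xy by (simp add: m_ac flip: double)
    also have "\<dots> = f x \<otimes> f y \<otimes> (f x \<otimes> f y)"
      unfolding shift[OF m_closed[OF xy(2,2)] xy(1)] double[OF xy(2)]
      using xy by (simp add: cl m_ac)
    finally show "f (x \<otimes> y) \<otimes> f (x \<otimes> y) = f x \<otimes> f y \<otimes> (f x \<otimes> f y)" .
  qed (use xy in \<open>simp_all add: cl\<close>)
  then show ?thesis using B cl by (auto simp: auto_def hom_def)
qed

lemma ord_quandle_auto_Core_eq:
  assumes bi: "bi_ordering G lt" and tf: "torsion_free G"
  shows "{g \<in> quandle_auto (Core G). order_preserving_on (carrier G) lt g}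
    = (\<lambda>(z, f). affine_map G z f) ` (carrier G \<times> ord_auto G lt)"
proof (intro equalityI subsetI)
  fix g assume "g \<in> {g \<in> quandle_auto (Core G). order_preserving_on (carrier G) lt g}"
  then have g: "g \<in> quandle_auto (Core G)" and ord: "order_preserving_on (carrier G) lt g"
    by auto
  have B: "g \<in> Bij (carrier G)"
    using g by (simp add: quandle_auto_def Core_def)
  have cl: "g x \<in> carrier G" if "x \<in> carrier G" for x
    using B that by (auto dest: Bij_imp_funcset)
  \<comment> \<open>Translating by the inverse of \<open>g \<one>\<close> makes the map fix
    \<open>\<one>\<close>, so \<open>Core_auto_fixing_one\<close> applies; translating back recovers
    \<open>g\<close>.\<close>
  define f where "f = affine_map G (inv (g \<one>)) g"
  have "f \<in> quandle_auto (Core G)"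
    using g by (simp add: f_def translate_Core cl)
  moreover have "f \<one> = \<one>" by (simp add: f_def cl)
  ultimately have "f \<in> auto G" by (rule Core_auto_fixing_one[OF tf])
  then have "f \<in> ord_auto G lt"
    using order_preserving_translate[OF bi _ cl ord] by (simp add: ord_auto_def f_def cl)
  moreover have "g = affine_map G (g \<one>) f"
    by (rule extensionalityI[of _ "carrier G"])
      (use B in \<open>auto simp: Bij_def affine_map_def f_def cl cancel_inv\<close>)
  ultimately show "g \<in> (\<lambda>(z, f). affine_map G z f) ` (carrier G \<times> ord_auto G lt)"
    using cl by force
qed (auto simp: ord_auto_def affine_map_Core auto_closed order_preserving_translate[OF bi])

lemma group_semidirect_OrdAutoGroup:
  assumes "bi_ordering G lt"
  shows "group (semidirect G (OrdAutoGroup G lt) (\<lambda>f g. f g))"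
  by (rule group_semidirect[OF is_group group_OrdAutoGroup[OF assms]])
    (auto simp: OrdAutoGroup_def AutoGroup_def BijGroup_def ord_auto_def auto_def compose_def)

lemma OrdQuandleAutoGroup_Core_iso:
  assumes bi: "bi_ordering G lt" and tf: "torsion_free G"
  shows "OrdQuandleAutoGroup (Core G) lt \<cong> semidirect G (OrdAutoGroup G lt) (\<lambda>f g. f g)"
proof -
  let ?S = "semidirect G (OrdAutoGroup G lt) (\<lambda>f g. f g)"
  let ?Q = "OrdQuandleAutoGroup (Core G) lt"
  let ?h = "\<lambda>(z, f). affine_map G z f"
  \<comment> \<open>With the carrier written as the image of \<open>?h\<close>, surjectivity is
    immediate.\<close>
  have Q: "?Q = (BijGroup (carrier G))\<lparr>carrier := ?h ` (carrier G \<times> ord_auto G lt)\<rparr>"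
    by (simp add: OrdQuandleAutoGroup_def flip: ord_quandle_auto_Core_eq[OF assms])
      (simp add: Core_def)
  have "?h \<in> mon ?S ?Q"
    using affine_map_mon[of "carrier G" "ord_auto G lt" "?h ` (carrier G \<times> ord_auto G lt)"]
    by (force simp: Q OrdAutoGroup_def ord_auto_def)
  moreover have "?h ` carrier ?S = carrier ?Q"
    by (simp add: Q semidirect_def OrdAutoGroup_def)
  ultimately have "?h \<in> iso ?S ?Q"
    by (auto simp: mon_def iso_def bij_betw_def)
  \<comment> \<open>The isomorphism starts at the semidirect product; reversing it relies on that
    product being a group.\<close>
  then have "?S \<cong> ?Q" by (rule is_isoI)
  then show ?thesis
    by (rule group.iso_sym[OF group_semidirect_OrdAutoGroup[OF bi]])
qed

end

section \<open>The embedding for the Alexander quandle\<close>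

lemma (in group) affine_map_mon_Alex:
  assumes bi: "bi_ordering G lt" and \<phi>: "\<phi> \<in> auto G"
  shows "(\<lambda>(z, f). affine_map G z f) \<in> mon
    (semidirect (G\<lparr>carrier := center G\<rparr>)
      ((AutoGroup G)\<lparr>carrier := centralizer (AutoGroup G) (ord_auto G lt) \<phi>\<rparr>) (\<lambda>f z. f z))
    (OrdQuandleAutoGroup (Alex G \<phi>) lt)"
proof -
  let ?K = "{g \<in> quandle_auto (Alex G \<phi>). order_preserving_on (carrier G) lt g}"
  let ?F = "centralizer (AutoGroup G) (ord_auto G lt) \<phi>"
  have F: "f \<in> auto G" "order_preserving_on (carrier G) lt f" if "f \<in> ?F" for f
    using that by (auto simp: centralizer_def ord_auto_def)
  have comm: "f (\<phi> x) = \<phi> (f x)" if "f \<in> ?F" "x \<in> carrier G" for f x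
  proof -
    \<comment> \<open>The centralizer is taken in \<open>AutoGroup G\<close>, whose product is
      \<open>compose\<close> on the carrier; evaluating at \<open>x\<close> gives pointwise
      commutation.\<close>
    have "compose (carrier G) f \<phi> = compose (carrier G) \<phi> f"
      using that(1) F(1)[OF that(1)] \<phi>
      by (simp add: centralizer_def AutoGroup_def BijGroup_def auto_Bij)
    from fun_cong[OF this, of x] show ?thesis using that(2) by (simp add: compose_def)
  qed
  have "affine_map G z f \<in> ?K" if "z \<in> center G" "f \<in> ?F" for z f
  proof -
    have "z \<in> carrier G" using that(1) by (simp add: center_def)
    then show ?thesis
      using affine_map_Alex[OF \<phi> that(1) F(1)[OF that(2)] comm[OF that(2)]]
        order_preserving_translate[OF bi _ auto_closed[OF F(1)] F(2)] that(2) by simp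
  qed
  then have "(\<lambda>(z, f). affine_map G z f) \<in> mon
    (semidirect (G\<lparr>carrier := center G\<rparr>) ((AutoGroup G)\<lparr>carrier := ?F\<rparr>) (\<lambda>f z. f z))
    ((BijGroup (carrier G))\<lparr>carrier := ?K\<rparr>)"
    by (intro affine_map_mon) (auto simp: center_def F(1))
  then show ?thesis by (simp add: OrdQuandleAutoGroup_def Alex_def)
qed

theorem proposition4p8:
  fixes G (structure) and lt :: "'a \<Rightarrow> 'a \<Rightarrow> bool" and \<phi> :: "'a \<Rightarrow> 'a"
  assumes "group G"
    and "bi_ordering G lt"
    and "\<phi> \<in> auto G"
    and "order_reversing_on (carrier G) lt \<phi>"
  shows "(\<exists>h. h \<in> mon
            (semidirect (G\<lparr>carrier := center G\<rparr>)
               ((AutoGroup G)\<lparr>carrier := centralizer (AutoGroup G) (ord_auto G lt) \<phi>\<rparr>)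
               (\<lambda>f z. f z))
            (OrdQuandleAutoGroup (Alex G \<phi>) lt))
       \<and> (comm_group G \<and> torsion_free G \<longrightarrow>
            OrdQuandleAutoGroup (Core G) lt
              \<cong> semidirect G (OrdAutoGroup G lt) (\<lambda>f g. f g))"
  using group.affine_map_mon_Alex[OF assms(1-3)]
    comm_group.OrdQuandleAutoGroup_Core_iso[OF _ assms(2)] by blast

end
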